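(* The number $\zeta(2)=\sum_{n=1}^{\infty}\frac{1}{n^2}$ is irrational.
   Context: For real $s>1$, $\zeta(s):=\sum_{n=1}^{\infty} 1/n^s$ is the Riemann zeta function. *)

theory Defs
  imports "HOL-Analysis.Analysis"
begin

(* Only meaningful for s > 1, where the series converges (see zeta_sums). The index is
   shifted, so that the term for n is 1 / (n + 1) powr s. *)
definition zeta :: "real \<Rightarrow> real" where
  "zeta s = (\<Sum>n. 1 / real (Suc n) powr s)"

lemma zeta_sums:
  assumes "s > 1"
  shows "(\<lambda>n. 1 / real (Suc n) powr s) sums zeta s"
proof -
  have "summable (\<lambda>n. real n powr (- s))"
    using assms by (subst summable_real_powr_iff) simp
  then have "summable (\<lambda>n. real (Suc n) powr (- s))"
    by (subst summable_Suc_iff)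
  then have "summable (\<lambda>n. 1 / real (Suc n) powr s)"
    by (simp add: powr_minus_divide)
  then show ?thesis
    unfolding zeta_def by (rule summable_sums)
qed

end

theory Submission
  imports Defs
begin

text \<open>
  By Euler's formula $\zeta(2) = \pi^2/6$ (\<open>inverse_squares_sums\<close>), it is enough that $\pi^2$ is
  irrational, and this is shown by Niven's argument. Suppose $\pi^2 = a/b$ with positive integers
  $a, b$. Take the integer polynomial $p = (X(1-X))^n$ and
  \[ G = \sum_{k \le n} (-b)^k a^{n-k} p^{(2k)}. \]
  The sum telescopes to $b\,G'' + a\,G = a^{n+1} p$, that is, $G'' + \pi^2 G = \pi^2 a^n p$
  (\<open>niven_sum_telescope\<close>). Since $(G'' + \pi^2 G)(x) \sin(\pi x)$ is the derivative of
  $G'(x) \sin(\pi x) - \pi\, G(x) \cos(\pi x)$, whose increment over $[0,1]$ is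
  $\pi(G(0) + G(1))$, the mean value theorem yields a point $0 < \xi < 1$ with
  \[ G(0) + G(1) = \pi a^n\, p(\xi) \sin(\pi\xi) \in (0, \pi a^n] \]
  (\<open>ex_poly_endpoint_sum_eq\<close>). Now $p$ vanishes to order $n$ at $0$ and at $1$, so all its
  derivatives there are multiples of $n!$ (\<open>fact_dvd_poly_higher_pderiv\<close>). Hence the positive
  integer $G(0) + G(1)$ is a multiple of $n!$, and $n! \le \pi a^n$. This cannot hold for all $n$,
  because $a^n/n! \to 0$.
\<close>

text \<open>
  The \<open>k\<close>-th derivative at \<open>c\<close> is \<open>fact k\<close> times a Taylor coefficient, which lies in the ring and
  is \<open>0\<close> for \<open>k < n\<close>; for \<open>k \<ge> n\<close>, \<open>fact k\<close> is a multiple of \<open>fact n\<close>. The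
  induction uses instead that one differentiation either lowers the exponent and contributes the
  factor \<open>n\<close>, or keeps the exponent and acts on the cofactor; hence the statement for all \<open>n\<close> and
  \<open>q\<close> at once.
\<close>

lemma fact_dvd_poly_higher_pderiv:
  fixes c :: "'a :: {idom, semiring_char_0}" and q :: "'a poly"
  shows "fact n dvd poly ((pderiv ^^ k) ([:- c, 1:] ^ n * q)) c"
proof (induction k arbitrary: n q)
  case 0
  then show ?case by (cases n) simp_all
next
  case (Suc k)
  show ?case
  proof (cases n)
    case 0
    then show ?thesis by simp
  next
    case (Suc m)
    have "pderiv ([:- c, 1:] ^ n * q) =
        smult (of_nat n) ([:- c, 1:] ^ m * q) + [:- c, 1:] ^ n * pderiv q"
      by (simp add: Suc pderiv_mult pderiv_power_Suc pderiv_pCons mult.commute del: power_Suc)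
    then have "poly ((pderiv ^^ Suc k) ([:- c, 1:] ^ n * q)) c =
        of_nat n * poly ((pderiv ^^ k) ([:- c, 1:] ^ m * q)) c
        + poly ((pderiv ^^ k) ([:- c, 1:] ^ n * pderiv q)) c"
      by (simp add: funpow_Suc_right higher_pderiv_add higher_pderiv_smult del: funpow.simps)
    moreover have "fact n dvd of_nat n * poly ((pderiv ^^ k) ([:- c, 1:] ^ m * q)) c"
      unfolding Suc fact_Suc by (intro mult_dvd_mono dvd_refl Suc.IH)
    ultimately show ?thesis
      using Suc.IH[of n "pderiv q"] by (simp add: dvd_add)
  qed
qed

text \<open>
  For \<open>\<pi>\<^sup>2 = a/b\<close> this is \<open>b\<^sup>n\<close> times Niven's sum of \<open>(-1)\<^sup>k \<pi>\<^bsup>2n-2k\<^esup> p\<^bsup>(2k)\<^esup>\<close>. Clearing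
  denominators in this form keeps the coefficients in the integers, so that divisibility can be
  stated there.
\<close>

definition niven_sum :: "'a :: idom \<Rightarrow> 'a \<Rightarrow> nat \<Rightarrow> 'a poly \<Rightarrow> 'a poly" where
  "niven_sum a b n p = (\<Sum>k\<le>n. smult ((- b) ^ k * a ^ (n - k)) ((pderiv ^^ (2 * k)) p))"

lemma niven_sum_Suc:
  "niven_sum a b (Suc n) p =
     smult a (niven_sum a b n p) + smult ((- b) ^ Suc n) ((pderiv ^^ (2 * Suc n)) p)"
proof -
  have "(\<Sum>k\<le>n. smult ((- b) ^ k * a ^ (Suc n - k)) ((pderiv ^^ (2 * k)) p)) =
      smult a (niven_sum a b n p)"
    unfolding niven_sum_def
    by (intro poly_eqI) (simp add: coeff_sum sum_distrib_left Suc_diff_le mult_ac)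
  then show ?thesis
    by (subst niven_sum_def) (simp del: funpow.simps)
qed

text \<open>
  Up to the scaling, the sum is a truncated Neumann series: \<open>b D\<^sup>2 + a\<close> applied to it cancels all
  terms but the first and the last, and the last vanishes if \<open>p\<close> has degree below \<open>2 (n + 1)\<close>.
\<close>

lemma niven_sum_telescope:
  "smult b (pderiv (pderiv (niven_sum a b n p))) + smult a (niven_sum a b n p) =
     smult (a ^ Suc n) p - smult ((- b) ^ Suc n) ((pderiv ^^ (2 * Suc n)) p)"
proof (induction n)
  case 0
  then show ?case by (simp add: niven_sum_def numeral_2_eq_2)
next
  case (Suc n)
  let ?G = "niven_sum a b n p" and ?D = "(pderiv ^^ (2 * Suc n)) p"
  have "smult b (pderiv (pderiv (niven_sum a b (Suc n) p))) + smult a (niven_sum a b (Suc n) p) =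
      smult a (smult b (pderiv (pderiv ?G)) + smult a ?G) + smult (a * (- b) ^ Suc n) ?D
      + smult (b * (- b) ^ Suc n) (pderiv (pderiv ?D))"
    by (simp add: niven_sum_Suc pderiv_add pderiv_smult smult_add_right algebra_simps
        del: funpow.simps power_Suc)
  also have "\<dots> = smult (a ^ Suc (Suc n)) p
      - smult ((- b) ^ Suc (Suc n)) ((pderiv ^^ (2 * Suc (Suc n))) p)"
    unfolding Suc.IH by (simp add: smult_diff_right smult_add_right algebra_simps)
  finally show ?case .
qed

lemma fact_dvd_poly_niven_sum:
  "fact n dvd poly (niven_sum a b m ([:- c, 1:] ^ n * q)) c"
  unfolding niven_sum_def poly_sum poly_smult
  by (intro dvd_sum dvd_mult fact_dvd_poly_higher_pderiv)

text \<open>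
  This takes the place of integrating \<open>(G'' + \<pi>\<^sup>2 G) sin (\<pi>x)\<close> over \<open>[0,1]\<close>: an antiderivative is
  explicit, and the intermediate point of the mean value theorem is as good as the integral for
  the estimate that follows.
\<close>

lemma ex_poly_endpoint_sum_eq:
  fixes G :: "real poly"
  obtains \<xi> where "0 < \<xi>" "\<xi> < 1"
    "pi * (poly G 0 + poly G 1) = (poly (pderiv (pderiv G)) \<xi> + pi\<^sup>2 * poly G \<xi>) * sin (pi * \<xi>)"
proof -
  define h where "h = (\<lambda>x. poly (pderiv G) x * sin (pi * x) - pi * poly G x * cos (pi * x))"
  have "DERIV h x :> (poly (pderiv (pderiv G)) x + pi\<^sup>2 * poly G x) * sin (pi * x)" for x
    unfolding h_def
    by (auto intro!: derivative_eq_intros poly_DERIV simp: algebra_simps power2_eq_square)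
  then obtain \<xi> where "0 < \<xi>" "\<xi> < 1"
    "h 1 - h 0 = (1 - 0) * ((poly (pderiv (pderiv G)) \<xi> + pi\<^sup>2 * poly G \<xi>) * sin (pi * \<xi>))"
    using MVT2[of 0 1 h "\<lambda>x. (poly (pderiv (pderiv G)) x + pi\<^sup>2 * poly G x) * sin (pi * x)"]
    by auto
  moreover have "h 1 - h 0 = pi * (poly G 0 + poly G 1)"
    by (simp add: h_def algebra_simps)
  ultimately show ?thesis using that by simp
qed

text \<open>
  The divisibility concerns an integer polynomial, the mean value theorem a real one; the
  coefficient embedding commutes with all operations that occur.
\<close>

lemma pderiv_map_poly_of_int:
  "pderiv (map_poly of_int p) = map_poly of_int (pderiv p :: int poly)"
  by (rule poly_eqI) (simp add: coeff_pderiv coeff_map_poly)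

lemma map_poly_of_int_add:
  "map_poly of_int (p + q) = map_poly of_int p + map_poly of_int (q :: int poly)"
  by (rule poly_eqI) (simp add: coeff_map_poly)

lemma map_poly_of_int_smult:
  "map_poly of_int (smult c p) = smult (of_int c) (map_poly of_int (p :: int poly))"
  by (rule poly_eqI) (simp add: coeff_map_poly)

lemma map_poly_of_int_power:
  "map_poly of_int (p ^ n :: int poly) = (map_poly of_int p ^ n :: 'a :: comm_ring_1 poly)"
proof -
  have mult: "map_poly of_int (p * q) = (map_poly of_int p * map_poly of_int q :: 'a poly)"
    for q :: "int poly"
    by (rule poly_eqI) (simp add: coeff_map_poly coeff_mult)
  show ?thesis by (induction n) (simp_all add: mult)
qed

lemma poly_map_poly_of_int:
  "poly (map_poly of_int p) (of_int x) = of_int (poly p x)"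
  by (induction p) (simp_all add: map_poly_pCons)

text \<open>
  The heart of the argument: an integer divisible by \<open>fact n\<close> is squeezed between \<open>0\<close> and
  \<open>\<pi> a\<^sup>n\<close>. The positivity of \<open>sin (\<pi>x)\<close> inside the unit interval ensures that the integer is not \<open>0\<close>.
\<close>

lemma fact_le_if_pi_squared_eq:
  fixes a b :: int
  assumes "a > 0" "b > 0" and pi2: "pi\<^sup>2 = of_int a / of_int b"
  shows "fact n \<le> pi * of_int a ^ n"
proof -
  define p :: "int poly" where "p = ([:0, 1:] * [:1, -1:]) ^ n"
  define G where "G = niven_sum a b n p"
  define R :: "int poly \<Rightarrow> real poly" where "R = map_poly of_int"
  have R_p: "poly (R p) x = (x * (1 - x)) ^ n" for x
    unfolding R_def p_def map_poly_of_int_power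
    by (simp add: poly_power map_poly_pCons algebra_simps)

  have "p = [:- 0, 1:] ^ n * [:1, -1:] ^ n"
    by (simp add: p_def power_mult_distrib del: mult_pCons_left mult_pCons_right)
  then have dvd_0: "fact n dvd poly G 0"
    unfolding G_def by (simp only: fact_dvd_poly_niven_sum)
  have "[:0, 1:] * [:1, -1:] = [:- 1, 1:] * ([:0, -1:] :: int poly)"
    by simp
  \<comment> \<open>Near \<open>1\<close> the factor \<open>1 - X\<close> gives its sign to the cofactor, so as to fit the shape \<open>X - c\<close>.\<close>
  then have "p = [:- 1, 1:] ^ n * [:0, -1:] ^ n"
    unfolding p_def by (simp only: power_mult_distrib)
  then have dvd_1: "fact n dvd poly G 1"
    unfolding G_def by (simp only: fact_dvd_poly_niven_sum)

  have "degree p \<le> 2 * n"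
    unfolding p_def using degree_power_le[of "[:0, 1:] * [:1, -1::int:]" n] by simp
  then have "(pderiv ^^ (2 * Suc n)) p = 0"
    by (intro poly_eqI) (simp add: coeff_higher_pderiv coeff_eq_0 del: funpow.simps)
  then have G_eq: "smult b (pderiv (pderiv G)) + smult a G = smult (a ^ Suc n) p"
    unfolding G_def niven_sum_telescope by simp
  have G_real: "poly (pderiv (pderiv (R G))) x + pi\<^sup>2 * poly (R G) x =
      pi\<^sup>2 * of_int a ^ n * (x * (1 - x)) ^ n" for x
  proof -
    have "smult (of_int b) (pderiv (pderiv (R G))) + smult (of_int a) (R G) =
        smult (of_int a ^ Suc n) (R p)"
      using arg_cong[OF G_eq, of R]
      by (simp add: R_def map_poly_of_int_add map_poly_of_int_smult pderiv_map_poly_of_int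
          del: power_Suc)
    from arg_cong[OF this, of "\<lambda>q. poly q x"]
    have "of_int b * poly (pderiv (pderiv (R G))) x + of_int a * poly (R G) x =
        of_int a ^ Suc n * (x * (1 - x)) ^ n"
      by (simp add: R_p)
    then show ?thesis using \<open>b > 0\<close> by (simp add: pi2 field_simps)
  qed

  obtain \<xi> where \<xi>: "0 < \<xi>" "\<xi> < 1"
    and "pi * (poly (R G) 0 + poly (R G) 1) =
      (poly (pderiv (pderiv (R G))) \<xi> + pi\<^sup>2 * poly (R G) \<xi>) * sin (pi * \<xi>)"
    by (rule ex_poly_endpoint_sum_eq)
  moreover have "poly (R G) 0 + poly (R G) 1 = of_int (poly G 0 + poly G 1)"
    using poly_map_poly_of_int[of G 0, where 'a = real] poly_map_poly_of_int[of G 1, where 'a = real]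
    by (simp add: R_def)
  ultimately have val: "of_int (poly G 0 + poly G 1) =
      pi * of_int a ^ n * ((\<xi> * (1 - \<xi>)) ^ n * sin (pi * \<xi>))"
    unfolding G_real by (simp add: power2_eq_square)

  have "sin (pi * \<xi>) > 0"
    using \<xi> by (intro sin_gt_zero) simp_all
  then have "of_int (poly G 0 + poly G 1) > (0 :: real)"
    unfolding val using \<xi> \<open>a > 0\<close> by simp
  then have "fact n \<le> poly G 0 + poly G 1"
    using dvd_0 dvd_1 by (intro zdvd_imp_le dvd_add) simp_all
  then have "fact n \<le> real_of_int (poly G 0 + poly G 1)"
    by (metis of_int_fact of_int_le_iff)
  also have "\<dots> \<le> pi * of_int a ^ n"
  proof -
    have "(\<xi> * (1 - \<xi>)) ^ n * sin (pi * \<xi>) \<le> 1"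
      using \<xi> \<open>sin (pi * \<xi>) > 0\<close> by (intro mult_le_one power_le_one) (auto intro: mult_le_one)
    then show ?thesis
      unfolding val using \<open>a > 0\<close> by (intro mult_left_le) simp_all
  qed
  finally show ?thesis .
qed

theorem pi_squared_irrational: "pi\<^sup>2 \<notin> \<rat>"
proof
  assume "pi\<^sup>2 \<in> \<rat>"
  then obtain a b :: int where "b > 0" and pi2: "pi\<^sup>2 = of_int a / of_int b"
    by (elim Rats_cases') auto
  have "0 < pi\<^sup>2" by simp
  then have "a > 0" unfolding pi2 using \<open>b > 0\<close> by (simp add: zero_less_divide_iff)
  have "(\<lambda>n. real_of_int a ^ n / fact n) \<longlonglongrightarrow> 0"
    by (rule summable_LIMSEQ_zero) (use summable_exp[of "real_of_int a"] in \<open>simp add: field_simps\<close>)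
  then have "eventually (\<lambda>n. real_of_int a ^ n / fact n < 1 / pi) sequentially"
    by (rule order_tendstoD) simp
  then obtain n where "real_of_int a ^ n / fact n < 1 / pi"
    by (auto simp: eventually_sequentially)
  then have "pi * real_of_int a ^ n < fact n"
    by (simp add: field_simps)
  with fact_le_if_pi_squared_eq[OF \<open>a > 0\<close> \<open>b > 0\<close> pi2, of n] show False by simp
qed

theorem theorem1:
  shows "(\<lambda>n. 1 / (real (Suc n))\<^sup>2) sums zeta 2 \<and> zeta 2 \<notin> \<rat>"
proof
  show sums: "(\<lambda>n. 1 / (real (Suc n))\<^sup>2) sums zeta 2"
    using zeta_sums[of 2] by simp
  have "(\<lambda>n. 1 / (real (Suc n))\<^sup>2) sums (pi\<^sup>2 / 6)"
    using inverse_squares_sums by (simp add: add.commute)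
  with sums have "zeta 2 = pi\<^sup>2 / 6"
    by (rule sums_unique2)
  then have "pi\<^sup>2 = 6 * zeta 2" by simp
  then show "zeta 2 \<notin> \<rat>"
    using pi_squared_irrational by (metis Rats_mult Rats_number_of)
qed

end
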